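(* Let $n \geqslant m \geqslant 1$ be integers and let $\sigma^m = [\upsilon^0, \upsilon^1, \ldots, \upsilon^m]$ be an $m$-simplex in $\mathbb{R}^n$ with diameter $\mathrm{diam}(\sigma^m)$ and barycentric circumradius $\beta_{\rm cir}^m$. Then there exists a unique spherical surface of circumradius $\rho_{\rm cir}^m$ (the smallest radius of the spherical surfaces enclosing $\sigma^m$) that encloses $\sigma^m$, and $$\rho_{\rm cir}^m \leqslant \min\Bigl\{\beta_{\rm cir}^m,\ \bigl[m/(2m+2)\bigr]^{1/2}\,\mathrm{diam}(\sigma^m)\Bigr\}.$$
   Context: An $m$-simplex $[\upsilon^0,\ldots,\upsilon^m]$ in $\mathbb{R}^n$ is the convex hull of $m+1$ affinely independent points (its vertices); its barycenter is $\kappa^m=\frac1{m+1}\sum_{j=0}^m\upsilon^j$ and its diameter $\mathrm{diam}(\sigma^m)$ is the Euclidean length of its longest edge. A spherical surface (the boundary of a closed Euclidean ball in $\mathbb{R}^n$) encloses a set if the closed ball it bounds contains the set. The circumradius $\rho_{\rm cir}^m$ is the smallest radius of the spherical surfaces in $\mathbb{R}^n$ that enclose $\sigma^m$ (with arbitrary center). The barycentric circumradius $\beta_{\rm cir}^m$ is the smallest radius of a spherical surface centered at $\kappa^m$ that encloses $\sigma^m$. *)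

theory Defs
  imports "HOL-Analysis.Analysis"
begin

definition affinely_independent_points :: "nat \<Rightarrow> (nat \<Rightarrow> real ^ 'n) \<Rightarrow> bool" where
  "affinely_independent_points m v \<longleftrightarrow> inj_on v {..m} \<and> \<not> affine_dependent (v ` {..m})"

definition simplex_hull :: "nat \<Rightarrow> (nat \<Rightarrow> real ^ 'n) \<Rightarrow> (real ^ 'n) set" where
  "simplex_hull m v = convex hull (v ` {..m})"

definition barycenter :: "nat \<Rightarrow> (nat \<Rightarrow> real ^ 'n) \<Rightarrow> real ^ 'n" where
  "barycenter m v = (1 / (real m + 1)) *\<^sub>R (\<Sum>j\<le>m. v j)"

(* length of the longest edge; only meaningful for m >= 1 *)
definition simplex_diam :: "nat \<Rightarrow> (nat \<Rightarrow> real ^ 'n) \<Rightarrow> real" where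
  "simplex_diam m v = Max {dist (v i) (v j) | i j. i < j \<and> j \<le> m}"

definition spherical_surface :: "(real ^ 'n) set \<Rightarrow> real \<Rightarrow> bool" where
  "spherical_surface S r \<longleftrightarrow> 0 < r \<and> (\<exists>c. S = sphere c r)"

(* A sphere of positive radius bounds exactly one closed ball: see encloses_sphere_iff. *)
definition encloses :: "(real ^ 'n) set \<Rightarrow> (real ^ 'n) set \<Rightarrow> bool" where
  "encloses S A \<longleftrightarrow> (\<exists>c r. 0 < r \<and> S = sphere c r \<and> A \<subseteq> cball c r)"

(* The smallest radius is written as an infimum; that it is attained is part of the main
   theorem. *)
definition circumradius :: "(real ^ 'n) set \<Rightarrow> real" where
  "circumradius A = Inf {r. \<exists>S. spherical_surface S r \<and> encloses S A}"

(* The infimum is attained: see barycentric_circumradius_smallest. *)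
definition barycentric_circumradius :: "nat \<Rightarrow> (nat \<Rightarrow> real ^ 'n) \<Rightarrow> real" where
  "barycentric_circumradius m v =
     Inf {r. 0 < r \<and> encloses (sphere (barycenter m v) r) (simplex_hull m v)}"

lemma sphere_inject:
  fixes c c' :: "real ^ 'n"
  assumes "0 < r" "0 < r'" and eq: "sphere c r = sphere c' r'"
  shows "c = c' \<and> r = r'"
proof -
  have "c = c'"
  proof (rule ccontr)
    assume ne: "c \<noteq> c'"
    define d where "d = norm (c - c')"
    define u where "u = (1 / d) *\<^sub>R (c - c')"
    have d: "d > 0" using ne by (simp add: d_def)
    have u: "norm u = 1" and cu: "c - c' = d *\<^sub>R u" using d by (auto simp: u_def d_def)
    have "c + r *\<^sub>R u \<in> sphere c r" "c - r *\<^sub>R u \<in> sphere c r"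
      using u assms(1) by (auto simp: dist_norm)
    then have "norm (c + r *\<^sub>R u - c') = r'" "norm (c - r *\<^sub>R u - c') = r'"
      unfolding eq by (auto simp: dist_norm norm_minus_commute)
    moreover have "c + r *\<^sub>R u - c' = (d + r) *\<^sub>R u" "c - r *\<^sub>R u - c' = (d - r) *\<^sub>R u"
      using cu by (auto simp: algebra_simps)
    ultimately have "\<bar>d + r\<bar> = r'" "\<bar>d - r\<bar> = r'" using u by auto
    then show False using d assms by linarith
  qed
  moreover obtain x where "x \<in> sphere c r"
    using assms(1) by (metis sphere_eq_empty ex_in_conv not_less_iff_gr_or_eq)
  ultimately show ?thesis using eq by auto
qed

lemma encloses_sphere_iff:
  "0 < r \<Longrightarrow> encloses (sphere c r) A \<longleftrightarrow> A \<subseteq> cball c r"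
  unfolding encloses_def using sphere_inject by blast

lemma simplex_diam_eq_diameter:
  assumes "1 \<le> m"
  shows "simplex_diam m v = diameter (simplex_hull m v)"
proof -
  let ?E = "{dist (v i) (v j) | i j. i < j \<and> j \<le> m}"
  have "?E \<subseteq> (\<lambda>(i, j). dist (v i) (v j)) ` ({..m} \<times> {..m})" by auto
  then have fin: "finite ?E" by (rule finite_subset) auto
  have "dist (v 0) (v 1) \<in> ?E" using assms by auto
  then have ne: "?E \<noteq> {}" and "dist (v 0) (v 1) \<le> Max ?E"
    using fin by (blast, intro Max_ge)
  then have ge0: "0 \<le> Max ?E" using zero_le_dist[of "v 0" "v 1"] by linarith
  have edge: "dist (v i) (v j) \<le> Max ?E" if "i \<le> m" "j \<le> m" for i j
  proof (cases i j rule: linorder_cases)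
    case equal then show ?thesis using ge0 by simp
  next
    case less then show ?thesis using fin that by (intro Max_ge) auto
  next
    case greater
    then have "dist (v j) (v i) \<in> ?E" using that by blast
    then have "dist (v j) (v i) \<le> Max ?E" using fin by (intro Max_ge)
    then show ?thesis by (simp only: dist_commute)
  qed
  have bdd: "bounded (simplex_hull m v)"
    unfolding simplex_hull_def
    by (simp add: bounded_convex_hull finite_imp_bounded)
  have inh: "v i \<in> simplex_hull m v" if "i \<le> m" for i
    unfolding simplex_hull_def using that by (intro hull_inc) auto
  show ?thesis unfolding simplex_diam_def
  proof (rule antisym)
    show "Max ?E \<le> diameter (simplex_hull m v)"
      using fin ne inh diameter_bounded_bound[OF bdd]
      by (intro Max.boundedI) auto
    show "diameter (simplex_hull m v) \<le> Max ?E"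
    proof (rule diameter_le)
      fix x y assume "x \<in> simplex_hull m v" "y \<in> simplex_hull m v"
      then obtain a b where "a \<in> v ` {..m}" "b \<in> v ` {..m}" "norm (x - y) \<le> norm (a - b)"
        unfolding simplex_hull_def
        using simplex_extremal_le_exists[of "v ` {..m}" x y] by auto
      then show "norm (x - y) \<le> Max ?E"
        unfolding dist_norm[symmetric] by (smt (verit) edge imageE atMost_iff)
    qed (use ge0 in auto)
  qed
qed

lemma barycentric_circumradius_smallest:
  assumes "1 \<le> m" "affinely_independent_points m v"
  defines "\<beta> \<equiv> barycentric_circumradius m v"
  shows "0 < \<beta>" "encloses (sphere (barycenter m v) \<beta>) (simplex_hull m v)"
    "\<And>r. 0 < r \<Longrightarrow> encloses (sphere (barycenter m v) r) (simplex_hull m v) \<Longrightarrow> \<beta> \<le> r"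
proof -
  let ?k = "barycenter m v"
  let ?D = "(\<lambda>j. dist ?k (v j)) ` {..m}"
  let ?R = "{r. 0 < r \<and> encloses (sphere ?k r) (simplex_hull m v)}"
  have sub: "simplex_hull m v \<subseteq> cball ?k r \<longleftrightarrow> (\<forall>d\<in>?D. d \<le> r)" for r
    unfolding simplex_hull_def
    by (subst subset_hull) auto
  have "v 0 \<noteq> v 1"
    using assms(1,2) unfolding affinely_independent_points_def inj_on_def by force
  then obtain j where "j \<le> m" "0 < dist ?k (v j)"
    using assms(1) by (metis le0 zero_less_dist_iff)
  then have pos: "0 < Max ?D" by (subst Max_gr_iff) auto
  have "Max ?D \<in> ?R" using pos by (simp add: encloses_sphere_iff sub)
  moreover have low: "Max ?D \<le> r" if "r \<in> ?R" for r
  proof -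
    from that have "simplex_hull m v \<subseteq> cball ?k r" using encloses_sphere_iff by blast
    then have "\<forall>d\<in>?D. d \<le> r" by (simp only: sub)
    then show ?thesis by (intro Max.boundedI) auto
  qed
  ultimately have "\<beta> = Max ?D"
    unfolding \<beta>_def barycentric_circumradius_def by (intro cInf_eq_minimum)
  then show "0 < \<beta>" "encloses (sphere ?k \<beta>) (simplex_hull m v)"
    "\<And>r. 0 < r \<Longrightarrow> encloses (sphere ?k r) (simplex_hull m v) \<Longrightarrow> \<beta> \<le> r"
    using \<open>Max ?D \<in> ?R\<close> low by auto
qed

end

theory Submission
  imports Defs
begin

text \<open>
  A smallest enclosing ball of a bounded set exists by compactness, and it is unique because of the
  parallelogram law: two balls of radius \<open>r\<close> with distinct centres at distance \<open>d\<close> meet inside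
  a ball of radius \<open>sqrt (r\<^sup>2 - d\<^sup>2 / 4)\<close>. The centre \<open>c\<close> lies in the convex hull of the
  points at distance exactly \<open>r\<close>, since otherwise moving \<open>c\<close> towards this hull would shrink the
  ball. Write \<open>c = (\<Sum>x. u x *\<^sub>R x)\<close> with convex weights supported on the points at distance \<open>r\<close>.
  The cross terms of \<open>\<Sum>x. u x * (dist x a)\<^sup>2\<close> cancel, so for \<open>a\<close> of maximal weight
  \<open>2 r\<^sup>2 = (\<Sum>x. u x * (dist x a)\<^sup>2) \<le> (1 - u a) D\<^sup>2\<close>,
  where \<open>D\<close> is the diameter, and the weight of \<open>a\<close> is at least \<open>1 / (m + 1)\<close>.
\<close>

text \<open>Stated with closed balls and no condition on the sign of \<open>r\<close>, so that it
  applies equally to the vertices and to their convex hull. The competing balls range over all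
  centres.\<close>

definition smallest_enclosing_ball :: "'a::metric_space set \<Rightarrow> 'a \<Rightarrow> real \<Rightarrow> bool" where
  "smallest_enclosing_ball A c r \<longleftrightarrow>
     A \<subseteq> cball c r \<and> (\<forall>c' r'. A \<subseteq> cball c' r' \<longrightarrow> r \<le> r')"

lemma smallest_enclosing_ball_nonneg:
  assumes "smallest_enclosing_ball A c r" "A \<noteq> {}"
  shows "0 \<le> r"
proof -
  obtain a where "a \<in> A" using assms(2) by blast
  then have "dist c a \<le> r" using assms(1) by (auto simp: smallest_enclosing_ball_def)
  then show ?thesis using zero_le_dist[of c a] by linarith
qed

text \<open>The radius is minimised as a continuous function on a compact set of pairs (centre,
  radius).\<close>

lemma smallest_enclosing_ball_exists:
  fixes A :: "'a::heine_borel set"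
  assumes "bounded A" "A \<noteq> {}"
  obtains c r where "smallest_enclosing_ball A c r"
proof -
  obtain a where a: "a \<in> A" using assms(2) by blast
  obtain R where R: "A \<subseteq> cball a R" using assms(1) bounded_any_center[of A a] by (auto simp: subset_iff)
  have R0: "0 \<le> R" using R a by force
  define S where "S = (\<Inter>x\<in>A. {p. dist (fst p) x \<le> (snd p :: real)})"
  have "closed S" unfolding S_def
    by (intro closed_INT ballI closed_Collect_le continuous_intros)
  moreover have "compact (cball a R \<times> {0..R})" by (intro compact_Times) auto
  ultimately have "compact ((cball a R \<times> {0..R}) \<inter> S)" by (rule compact_Int_closed[rotated])
  moreover have aR: "(a, R) \<in> (cball a R \<times> {0..R}) \<inter> S" using R R0 by (auto simp: S_def)
  moreover have "continuous_on ((cball a R \<times> {0..R}) \<inter> S) snd" by (intro continuous_intros)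
  ultimately obtain p where p: "p \<in> (cball a R \<times> {0..R}) \<inter> S"
    and least: "\<forall>q\<in>(cball a R \<times> {0..R}) \<inter> S. snd p \<le> snd q"
    by (metis continuous_attains_inf empty_iff)
  \<comment> \<open>A ball of radius at most \<open>R\<close> containing \<open>a\<close> has its
    centre within \<open>R\<close> of \<open>a\<close>, so it competes in the compact set; a larger
    radius loses to \<open>snd p \<le> R\<close> anyway.\<close>
  have "snd p \<le> r'" if sub: "A \<subseteq> cball c' r'" for c' r'
  proof (cases "r' \<le> R")
    case True
    have "dist c' a \<le> r'" using sub a by auto
    moreover from this have "0 \<le> r'" using zero_le_dist[of c' a] by linarith
    ultimately have "(c', r') \<in> (cball a R \<times> {0..R}) \<inter> S"
      using True sub by (auto simp: S_def dist_commute)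
    then show ?thesis using least by force
  next
    case False
    then show ?thesis using p by (auto simp: mem_Times_iff)
  qed
  moreover have "A \<subseteq> cball (fst p) (snd p)" using p by (auto simp: S_def)
  ultimately have "smallest_enclosing_ball A (fst p) (snd p)"
    by (auto simp: smallest_enclosing_ball_def)
  then show ?thesis by (rule that)
qed

lemma smallest_enclosing_ball_unique:
  fixes A :: "'a::real_inner set"
  assumes c: "smallest_enclosing_ball A c r" and ne: "A \<noteq> {}" and c': "A \<subseteq> cball c' r"
  shows "c' = c"
proof (rule ccontr)
  assume "c' \<noteq> c"
  \<comment> \<open>By the median formula, \<open>s\<close> bounds the squared distance from the
    midpoint of the centres to any point of \<open>A\<close>.\<close>
  define s where "s = r\<^sup>2 - (norm (c - c'))\<^sup>2 / 4"
  have s: "(dist (midpoint c c') x)\<^sup>2 \<le> s" if "x \<in> A" for x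
  proof -
    have "dist c x \<le> r" "dist c' x \<le> r"
      using that c c' by (auto simp: smallest_enclosing_ball_def)
    then have "(norm (c - x))\<^sup>2 \<le> r\<^sup>2" "(norm (c' - x))\<^sup>2 \<le> r\<^sup>2"
      by (simp_all add: dist_norm power_mono)
    moreover have "(dist (midpoint c c') x)\<^sup>2
        = (norm (c - x))\<^sup>2 / 2 + (norm (c' - x))\<^sup>2 / 2 - (norm (c - c'))\<^sup>2 / 4"
      by (simp add: midpoint_def dist_norm power2_norm_eq_inner inner_diff_left inner_diff_right
          inner_add_left inner_add_right inner_commute field_simps)
    ultimately show ?thesis unfolding s_def by linarith
  qed
  have "A \<subseteq> cball (midpoint c c') (sqrt s)" using s real_le_rsqrt by auto
  then have "r \<le> sqrt s" using c by (auto simp: smallest_enclosing_ball_def)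
  moreover have "sqrt s < r"
  proof (rule real_less_lsqrt)
    show "0 \<le> r" using smallest_enclosing_ball_nonneg[OF c ne] .
    show "s < r\<^sup>2" using \<open>c' \<noteq> c\<close> by (simp add: s_def)
  qed
  ultimately show False by linarith
qed

lemma smallest_enclosing_ball_center_in_hull:
  fixes A :: "'a::euclidean_space set"
  assumes c: "smallest_enclosing_ball A c r" and fin: "finite A" and ne: "A \<noteq> {}"
  shows "c \<in> convex hull {x \<in> A. dist c x = r}"
proof (rule ccontr)
  define K where "K = convex hull {x \<in> A. dist c x = r}"
  assume "c \<notin> convex hull {x \<in> A. dist c x = r}"
  then have cK: "c \<notin> K" by (simp add: K_def)
  have le: "dist c x \<le> r" if "x \<in> A" for x
    using that c by (auto simp: smallest_enclosing_ball_def)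
  have conv: "convex K" by (simp add: K_def)
  have "compact K" unfolding K_def using fin by (intro finite_imp_compact_convex_hull) auto
  then have clo: "closed K" by (rule compact_imp_closed)
  \<comment> \<open>If \<open>K\<close> is empty, \<open>c\<close> need not move: all points are closer than \<open>r\<close> already.\<close>
  define p where "p = (if K = {} then c else closest_point K c)"
  \<comment> \<open>Points at distance \<open>r\<close> come closer because \<open>p\<close> lies on
    their side of \<open>c\<close>; all others stay closer than \<open>r\<close> by
    continuity.\<close>
  have near: "\<forall>\<^sub>F t in at_right 0. dist (c + t *\<^sub>R (p - c)) x < r" if x: "x \<in> A" for x
  proof (cases "dist c x = r")
    case True
    then have xK: "x \<in> K" using x by (simp add: K_def hull_inc)
    then have p: "p = closest_point K c" by (auto simp: p_def)
    have "p \<in> K" using p xK clo closest_point_in_set by blast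
    then have d: "0 < (norm (p - c))\<^sup>2" using cK by auto
    have "(c - p) \<bullet> (x - p) \<le> 0" unfolding p by (rule closest_point_dot[OF conv clo xK])
    then have dot: "(p - c) \<bullet> (c - x) \<le> - (norm (p - c))\<^sup>2"
      by (simp add: power2_norm_eq_inner inner_diff_left inner_diff_right inner_commute)
    \<comment> \<open>The linear term in \<open>t\<close> contributes at most
      \<open>- 2 * t * (norm (p - c))\<^sup>2\<close>, which outweighs the quadratic term as long as
      \<open>t < 1\<close>.\<close>
    have "dist (c + t *\<^sub>R (p - c)) x < r" if t: "0 < t" "t < 1" for t
    proof (rule power2_less_imp_less)
      show "0 \<le> r" using smallest_enclosing_ball_nonneg[OF c ne] .
      have "(dist (c + t *\<^sub>R (p - c)) x)\<^sup>2 = (norm ((c - x) + t *\<^sub>R (p - c)))\<^sup>2"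
        by (simp add: dist_norm algebra_simps)
      also have "\<dots> = r\<^sup>2 + 2 * t * ((p - c) \<bullet> (c - x)) + t * t * (norm (p - c))\<^sup>2"
        unfolding True[symmetric] dist_norm power2_norm_eq_inner inner_add_left inner_add_right
          inner_scaleR_left inner_scaleR_right
        by (simp add: inner_commute algebra_simps)
      also have "\<dots> \<le> r\<^sup>2 + 2 * t * (- (norm (p - c))\<^sup>2) + t * t * (norm (p - c))\<^sup>2"
        using dot t by (intro add_mono mult_left_mono) auto
      also have "\<dots> = r\<^sup>2 - t * (2 - t) * (norm (p - c))\<^sup>2" by (simp add: algebra_simps)
      also have "\<dots> < r\<^sup>2" using t d by simp
      finally show "(dist (c + t *\<^sub>R (p - c)) x)\<^sup>2 < r\<^sup>2" .
    qed
    then show ?thesis unfolding eventually_at_right_field by (intro exI[of _ 1]) auto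
  next
    case False
    then have "dist c x < r" using le[OF x] by simp
    moreover have "((\<lambda>t. dist (c + t *\<^sub>R (p - c)) x) \<longlongrightarrow> dist (c + 0 *\<^sub>R (p - c)) x) (at_right 0)"
      by (intro tendsto_intros)
    ultimately show ?thesis using order_tendstoD(2) by fastforce
  qed
  \<comment> \<open>Finiteness of \<open>A\<close> lets a single \<open>t\<close> serve all points,
    and then makes the largest distance from the new centre strictly less than
    \<open>r\<close>.\<close>
  have "\<forall>\<^sub>F t in at_right 0. \<forall>x\<in>A. dist (c + t *\<^sub>R (p - c)) x < r"
    using near by (intro eventually_ball_finite fin) auto
  then obtain t where t: "\<forall>x\<in>A. dist (c + t *\<^sub>R (p - c)) x < r"
    using eventually_happens' trivial_limit_at_right_real by blast
  define q where "q = c + t *\<^sub>R (p - c)"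
  have "A \<subseteq> cball q (Max (dist q ` A))" using fin by auto
  then have "r \<le> Max (dist q ` A)" using c by (auto simp: smallest_enclosing_ball_def)
  moreover have "Max (dist q ` A) < r" using fin ne t by (auto simp: q_def)
  ultimately show False by linarith
qed

lemma finite_max_ge_average:
  fixes u :: "'a \<Rightarrow> real"
  assumes "finite A" "A \<noteq> {}"
  obtains a where "a \<in> A" "sum u A \<le> real (card A) * u a"
proof -
  have "Max (u ` A) \<in> u ` A" using assms by (intro Max_in) auto
  then obtain a where a: "a \<in> A" "Max (u ` A) = u a" by blast
  then have "\<forall>x\<in>A. u x \<le> u a" using assms(1) Max_ge[of "u ` A"] by force
  then have "sum u A \<le> real (card A) * u a" by (intro sum_bounded_above) auto
  with a(1) that show ?thesis by blast
qed

text \<open>This is Jung's inequality with a constant governed by the number of points instead of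
  the dimension of the space.\<close>

theorem Jung_finite:
  fixes A :: "'a::euclidean_space set"
  assumes c: "smallest_enclosing_ball A c r" and fin: "finite A" and ne: "A \<noteq> {}"
    and D: "\<And>x y. x \<in> A \<Longrightarrow> y \<in> A \<Longrightarrow> dist x y \<le> D"
  shows "2 * r\<^sup>2 \<le> (1 - 1 / real (card A)) * D\<^sup>2"
proof -
  let ?B = "{x \<in> A. dist c x = r}"
  have finB: "finite ?B" using fin by simp
  obtain u where u0: "\<And>x. x \<in> ?B \<Longrightarrow> 0 \<le> u x" and u1: "sum u ?B = 1"
    and uc: "(\<Sum>x\<in>?B. u x *\<^sub>R x) = c"
    using smallest_enclosing_ball_center_in_hull[OF c fin ne] finB
    by (auto simp: convex_hull_finite)
  have "?B \<noteq> {}" using u1 by force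
  then obtain a where a: "a \<in> ?B" "sum u ?B \<le> real (card ?B) * u a"
    using finite_max_ge_average[OF finB] by blast
  \<comment> \<open>The largest weight is at least \<open>1 / card ?B\<close>; this is weakened to
    \<open>1 / card A\<close>, because the number of points at distance \<open>r\<close> is not
    known.\<close>
  have "card ?B \<le> card A" using fin by (intro card_mono) auto
  then have "real (card ?B) * u a \<le> real (card A) * u a" using u0 a(1) by (intro mult_right_mono) auto
  with a u1 have ua: "1 / real (card A) \<le> u a"
    using fin ne by (simp add: card_gt_0_iff field_simps)
  \<comment> \<open>The inner product is kept linear in
    \<open>u x *\<^sub>R x - u x *\<^sub>R c\<close>, whose sum over \<open>?B\<close> is
    \<open>c - c = 0\<close>.\<close>
  have expand: "u x * (dist x a)\<^sup>2 = u x * (2 * r\<^sup>2) - 2 * ((u x *\<^sub>R x - u x *\<^sub>R c) \<bullet> (a - c))"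
    if "x \<in> ?B" for x
  proof -
    have "(dist x a)\<^sup>2 = (dist c x)\<^sup>2 + (dist c a)\<^sup>2 - 2 * ((x - c) \<bullet> (a - c))"
      by (simp add: dist_norm power2_norm_eq_inner inner_diff_left inner_diff_right inner_commute)
    also have "\<dots> = 2 * r\<^sup>2 - 2 * ((x - c) \<bullet> (a - c))" using that a(1) by simp
    finally have "u x * (dist x a)\<^sup>2 = u x * (2 * r\<^sup>2 - 2 * ((x - c) \<bullet> (a - c)))" by simp
    also have "u x * (2 * r\<^sup>2 - 2 * ((x - c) \<bullet> (a - c)))
        = u x * (2 * r\<^sup>2) - 2 * ((u x *\<^sub>R (x - c)) \<bullet> (a - c))"
      by (simp add: right_diff_distrib)
    finally show ?thesis by (simp only: scaleR_diff_right)
  qed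
  have "(\<Sum>x\<in>?B. u x * (dist x a)\<^sup>2)
      = (\<Sum>x\<in>?B. u x * (2 * r\<^sup>2) - 2 * ((u x *\<^sub>R x - u x *\<^sub>R c) \<bullet> (a - c)))"
    using expand by (rule sum.cong[OF refl])
  also have "\<dots> = sum u ?B * (2 * r\<^sup>2)
      - 2 * (((\<Sum>x\<in>?B. u x *\<^sub>R x) - sum u ?B *\<^sub>R c) \<bullet> (a - c))"
    by (simp only: sum_subtractf sum_distrib_right sum_distrib_left[symmetric]
        inner_sum_left[symmetric] scaleR_left.sum)
  also have "\<dots> = 2 * r\<^sup>2" by (simp only: u1 uc) simp
  finally have "2 * r\<^sup>2 = (\<Sum>x\<in>?B. u x * (dist x a)\<^sup>2)" ..
  \<comment> \<open>The term at \<open>a\<close> vanishes, so its weight drops out; this is the gain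
    over the trivial bound \<open>D\<^sup>2\<close>.\<close>
  also have "\<dots> = (\<Sum>x\<in>?B - {a}. u x * (dist x a)\<^sup>2)"
    using finB a(1) by (simp add: sum.remove)
  also have "\<dots> \<le> (\<Sum>x\<in>?B - {a}. u x * D\<^sup>2)"
    using u0 D a(1) by (intro sum_mono mult_left_mono power_mono) auto
  also have "\<dots> = (1 - u a) * D\<^sup>2"
    using finB a(1) u1 by (simp add: sum_distrib_right[symmetric] sum_diff1)
  also have "\<dots> \<le> (1 - 1 / real (card A)) * D\<^sup>2"
    using ua by (intro mult_right_mono) auto
  finally show ?thesis .
qed

text \<open>A sphere of positive radius determines its centre and radius, so the ball witnessing
  \<open>encloses\<close> has the radius named by \<open>spherical_surface\<close>.\<close>

lemma encloses_of_radius_iff: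
  "spherical_surface S r \<and> encloses S A \<longleftrightarrow> 0 < r \<and> (\<exists>c. S = sphere c r \<and> A \<subseteq> cball c r)"
  unfolding spherical_surface_def using encloses_sphere_iff by blast

text \<open>Positivity makes \<open>r\<close> itself an admissible radius, so the infimum is a
  minimum.\<close>

lemma circumradius_eq_smallest:
  assumes "smallest_enclosing_ball A c r" "0 < r"
  shows "circumradius A = r"
  unfolding circumradius_def encloses_of_radius_iff
  using assms by (intro cInf_eq_minimum) (auto simp: smallest_enclosing_ball_def)

theorem theorem3p11:
  fixes m :: nat and v :: "nat \<Rightarrow> real ^ 'n"
  assumes "1 \<le> m" and "m \<le> CARD('n)"
    and "affinely_independent_points m v"
  shows "(\<exists>!S. spherical_surface S (circumradius (simplex_hull m v)) \<and>
               encloses S (simplex_hull m v)) \<and>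
         circumradius (simplex_hull m v)
           \<le> min (barycentric_circumradius m v)
                 (sqrt (real m / (2 * real m + 2)) * simplex_diam m v)"
proof -
  let ?A = "v ` {..m}" and ?H = "simplex_hull m v"
  have inj: "inj_on v {..m}" using assms(3) by (simp add: affinely_independent_points_def)
  have cardA: "card ?A = Suc m" using inj by (simp add: card_image)
  have bH: "bounded ?H"
    by (simp add: simplex_hull_def bounded_convex_hull finite_imp_bounded)
  have AH: "?A \<subseteq> ?H" by (simp add: simplex_hull_def hull_subset)
  have "?A \<noteq> {}" by simp
  then obtain c r where c: "smallest_enclosing_ball ?A c r"
    using smallest_enclosing_ball_exists[of ?A] by (auto simp: finite_imp_bounded)
  \<comment> \<open>Balls are convex, so enclosing the simplex amounts to enclosing its
    vertices.\<close>
  have sub: "?H \<subseteq> cball c' r' \<longleftrightarrow> ?A \<subseteq> cball c' r'" for c' r'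
    unfolding simplex_hull_def by (rule subset_hull) simp
  have cH: "smallest_enclosing_ball ?H c r"
    using c by (simp add: smallest_enclosing_ball_def sub)
  \<comment> \<open>A radius that is not positive would force all vertices onto \<open>c\<close>,
    yet \<open>v 0\<close> and \<open>v 1\<close> differ.\<close>
  have r: "0 < r"
  proof (rule ccontr)
    assume "\<not> 0 < r"
    have "c = v i" if "i \<le> m" for i
    proof -
      have "dist c (v i) \<le> r" using c that by (auto simp: smallest_enclosing_ball_def)
      then have "dist c (v i) \<le> 0" using \<open>\<not> 0 < r\<close> by linarith
      then show ?thesis by simp
    qed
    from this[of 0, symmetric] this[of 1] have "v 0 = v 1" using assms(1) by simp
    then show False using inj_onD[OF inj, of 0 1] assms(1) by simp
  qed
  have rad: "circumradius ?H = r" using cH r by (rule circumradius_eq_smallest)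
  have "\<exists>!S. spherical_surface S r \<and> encloses S ?H"
    unfolding encloses_of_radius_iff
  proof (rule ex1I[where a = "sphere c r"])
    show "0 < r \<and> (\<exists>c'. sphere c r = sphere c' r \<and> ?H \<subseteq> cball c' r)"
      using r cH by (auto simp: smallest_enclosing_ball_def)
  qed (use smallest_enclosing_ball_unique[OF cH] AH in auto)
  moreover have "r \<le> barycentric_circumradius m v"
    using barycentric_circumradius_smallest(1,2)[OF assms(1,3)] cH
    by (simp add: encloses_sphere_iff smallest_enclosing_ball_def)
  moreover have "r \<le> sqrt (real m / (2 * real m + 2)) * simplex_diam m v"
  proof -
    let ?D = "simplex_diam m v"
    have D: "dist x y \<le> ?D" if "x \<in> ?A" "y \<in> ?A" for x y
      unfolding simplex_diam_eq_diameter[OF assms(1)]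
      using that AH bH by (intro diameter_bounded_bound) auto
    have D0: "0 \<le> ?D" using D[of "v 0" "v 0"] by simp
    \<comment> \<open>With \<open>m + 1\<close> vertices the factor is \<open>m / (m + 1)\<close>,
      and halving it gives the constant of the theorem.\<close>
    have "2 * r\<^sup>2 \<le> (1 - 1 / real (card ?A)) * ?D\<^sup>2"
      by (rule Jung_finite[OF c]) (use D in auto)
    then have "r\<^sup>2 \<le> (real m / (2 * real m + 2)) * ?D\<^sup>2"
      unfolding cardA by (simp add: field_simps)
    then have "r \<le> sqrt ((real m / (2 * real m + 2)) * ?D\<^sup>2)" by (rule real_le_rsqrt)
    also have "\<dots> = sqrt (real m / (2 * real m + 2)) * ?D" using D0
      by (simp only: real_sqrt_mult real_sqrt_abs abs_of_nonneg)
    finally show ?thesis .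
  qed
  ultimately show ?thesis unfolding rad by simp
qed

end
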